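(* Let $(Q,\sigma)$ and $(Q,\sigma')$ be wiggle equivalent cyclically ordered quivers. Suppose that a vertex $j$ is proper in both $(Q,\sigma)$ and $(Q,\sigma')$. Then the cyclically ordered quivers $\mu_j(Q,\sigma)$ and $\mu_j(Q,\sigma')$ (results of proper mutation at $j$) are wiggle equivalent.
   Context: A quiver is a finite directed graph without loops or oriented 2-cycles; multiple arrows are allowed. Mutation $\mu_j$ of a quiver at a vertex $j$: for each path $i\to j\to k$ add an arrow $i\to k$; reverse all arrows incident to $j$; repeatedly remove oriented 2-cycles. A cyclic ordering $\sigma=(v_1,\dots,v_n)$ of the vertex set is a linear ordering considered up to cyclic shifts ("clockwise" placement on a circle). A cyclically ordered quiver (COQ) $(Q,\sigma)$ is a quiver with a cyclic ordering of its vertices. A wiggle transforms $(Q,\sigma)$ into $(Q,\sigma')$ where $\sigma'$ is obtained from $\sigma$ by interchanging two vertices that are consecutive in $\sigma$ and not adjacent in $Q$. Wiggle equivalence is the equivalence relation generated by wiggles. A path $i\to j\to k$ in $Q$ makes a right turn at $j$ if $\sigma=(\dots,i,\dots,j,\dots,k,\dots)$ (i.e., going clockwise from $i$ one meets $j$ before $k$). A vertex $j$ is proper in $(Q,\sigma)$ if every oriented two-arrow path $i\to j\to k$ in $Q$ makes a right turn at $j$. Let $\operatorname{In}(j)$ (resp., $\operatorname{Out}(j)$) be the set of vertices $i$ with an arrow $i\to j$ (resp., $j\to i$) in $Q$. If $j$ is proper, the proper mutation $\mu_j(Q,\sigma)$ is the quiver $\mu_j(Q)$ with the cyclic ordering obtained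 from $\sigma$ by keeping the placement of all vertices other than $j$ and moving $j$ clockwise past all the vertices in $\operatorname{Out}(j)$ (each exactly once) without passing any vertex in $\operatorname{In}(j)$. This placement is well defined up to wiggles of the mutated COQ; for a sink or source $j$ the cyclic ordering does not change (up to wiggles). *)

theory Defs
  imports Main
begin

section \<open>Quivers and mutation\<close>

text \<open>
  A finite directed multigraph is encoded by its vertex set and its arrow
  multiplicities: \<open>arrows Q i j\<close> is the number of arrows \<open>i \<rightarrow> j\<close>.
\<close>

record 'v quiver =
  verts :: "'v set"
  arrows :: "'v \<Rightarrow> 'v \<Rightarrow> nat"

definition is_quiver :: "'v quiver \<Rightarrow> bool" where
  "is_quiver Q \<longleftrightarrow>
     finite (verts Q) \<and>
     (\<forall>i j. arrows Q i j > 0 \<longrightarrow> i \<in> verts Q \<and> j \<in> verts Q) \<and>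
     (\<forall>i. arrows Q i i = 0) \<and>
     (\<forall>i j. arrows Q i j = 0 \<or> arrows Q j i = 0)"

definition In :: "'v quiver \<Rightarrow> 'v \<Rightarrow> 'v set" where
  "In Q j = {i. arrows Q i j > 0}"

definition Out :: "'v quiver \<Rightarrow> 'v \<Rightarrow> 'v set" where
  "Out Q j = {k. arrows Q j k > 0}"

definition adjacent :: "'v quiver \<Rightarrow> 'v \<Rightarrow> 'v \<Rightarrow> bool" where
  "adjacent Q i k \<longleftrightarrow> arrows Q i k > 0 \<or> arrows Q k i > 0"

text \<open>
  There are \<open>arrows Q i j * arrows Q j k\<close> paths \<open>i \<rightarrow> j \<rightarrow> k\<close>; since \<open>Q\<close> has no
  loops, no arrow incident to \<open>j\<close> itself is added.
\<close>

definition add_shortcuts :: "'v \<Rightarrow> 'v quiver \<Rightarrow> 'v quiver" where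
  "add_shortcuts j Q =
     Q\<lparr>arrows := (\<lambda>i k. arrows Q i k + arrows Q i j * arrows Q j k)\<rparr>"

definition reverse_at :: "'v \<Rightarrow> 'v quiver \<Rightarrow> 'v quiver" where
  "reverse_at j Q =
     Q\<lparr>arrows := (\<lambda>i k. if i = j \<or> k = j then arrows Q k i else arrows Q i k)\<rparr>"

text \<open>
  Removing oriented 2-cycles one at a time until none is left cancels
  \<open>min (arrows Q i k) (arrows Q k i)\<close> arrows in each direction, which is what the
  truncated subtraction on \<open>nat\<close> expresses.
\<close>

definition cancel_2cycles :: "'v quiver \<Rightarrow> 'v quiver" where
  "cancel_2cycles Q = Q\<lparr>arrows := (\<lambda>i k. arrows Q i k - arrows Q k i)\<rparr>"

definition mutate :: "'v \<Rightarrow> 'v quiver \<Rightarrow> 'v quiver" where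
  "mutate j Q = cancel_2cycles (reverse_at j (add_shortcuts j Q))"

lemma mutate_verts [simp]: "verts (mutate j Q) = verts Q"
  by (simp add: mutate_def cancel_2cycles_def reverse_at_def add_shortcuts_def)

lemma is_quiver_mutate:
  assumes "is_quiver Q" "j \<in> verts Q"
  shows "is_quiver (mutate j Q)"
proof -
  let ?m = "arrows (mutate j Q)"
  have m: "?m i k = (if i = j \<or> k = j then arrows Q k i + arrows Q k j * arrows Q j i
      - (arrows Q i k + arrows Q i j * arrows Q j k)
    else arrows Q i k + arrows Q i j * arrows Q j k
      - (arrows Q k i + arrows Q k j * arrows Q j i))" for i k
    by (auto simp: mutate_def cancel_2cycles_def reverse_at_def add_shortcuts_def)
  have out: "arrows Q i k = 0" if "i \<notin> verts Q \<or> k \<notin> verts Q" for i k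
    using assms(1) that unfolding is_quiver_def by (metis not_gr_zero)
  have "i \<in> verts Q \<and> k \<in> verts Q" if "?m i k > 0" for i k
  proof (rule ccontr)
    assume "\<not> (i \<in> verts Q \<and> k \<in> verts Q)"
    then have "?m i k = 0" using out assms(2) by (auto simp: m)
    with that show False by simp
  qed
  moreover have "?m i i = 0" "?m i k = 0 \<or> ?m k i = 0" for i k
    by (auto simp: m)
  moreover have "finite (verts Q)" using assms(1) by (simp add: is_quiver_def)
  ultimately show ?thesis unfolding is_quiver_def by auto
qed

section \<open>Cyclic orderings and cyclically ordered quivers\<close>

text \<open>
  A cyclic ordering is the class, under cyclic shifts, of a linear ordering; the
  latter is a repetition-free list of the vertices, read clockwise.
\<close>

definition cyc :: "'v list \<Rightarrow> 'v list set" where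
  "cyc xs = {rotate n xs | n. True}"

definition cyclic_ordering :: "'v set \<Rightarrow> 'v list set \<Rightarrow> bool" where
  "cyclic_ordering V \<sigma> \<longleftrightarrow> (\<exists>xs. distinct xs \<and> set xs = V \<and> \<sigma> = cyc xs)"

type_synonym 'v coq = "'v quiver \<times> 'v list set"

fun is_coq :: "'v coq \<Rightarrow> bool" where
  "is_coq (Q, \<sigma>) \<longleftrightarrow> is_quiver Q \<and> cyclic_ordering (verts Q) \<sigma>"

text \<open>
  Any two cyclically consecutive vertices are the first two entries of some
  representative list.
\<close>

inductive wiggle :: "'v coq \<Rightarrow> 'v coq \<Rightarrow> bool" where
  "is_coq (Q, cyc (u # v # ws)) \<Longrightarrow> \<not> adjacent Q u v \<Longrightarrow>
   wiggle (Q, cyc (u # v # ws)) (Q, cyc (v # u # ws))"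

abbreviation wiggle_equivalent :: "'v coq \<Rightarrow> 'v coq \<Rightarrow> bool" where
  "wiggle_equivalent \<equiv> equivclp wiggle"

definition right_turn :: "'v list set \<Rightarrow> 'v \<Rightarrow> 'v \<Rightarrow> 'v \<Rightarrow> bool" where
  "right_turn \<sigma> i j k \<longleftrightarrow> (\<exists>as bs cs ds. as @ [i] @ bs @ [j] @ cs @ [k] @ ds \<in> \<sigma>)"

fun proper :: "'v \<Rightarrow> 'v coq \<Rightarrow> bool" where
  "proper j (Q, \<sigma>) \<longleftrightarrow>
     j \<in> verts Q \<and> (\<forall>i k. i \<in> In Q j \<and> k \<in> Out Q j \<longrightarrow> right_turn \<sigma> i j k)"

text \<open>
  The placement of \<open>j\<close> after a proper mutation is only determined up to wiggles,
  so proper mutation is a relation: \<open>proper_mutation j C C'\<close> says that \<open>C'\<close> arises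
  from \<open>C\<close> by an admissible choice of placement. Starting from a representative
  with \<open>j\<close> in front, \<open>as\<close> lists the vertices that \<open>j\<close> passes while moving clockwise.
\<close>

inductive proper_mutation :: "'v \<Rightarrow> 'v coq \<Rightarrow> 'v coq \<Rightarrow> bool" where
  "is_coq (Q, \<sigma>) \<Longrightarrow> proper j (Q, \<sigma>) \<Longrightarrow> j # as @ bs \<in> \<sigma> \<Longrightarrow>
   Out Q j \<subseteq> set as \<Longrightarrow> In Q j \<inter> set as = {} \<Longrightarrow>
   proper_mutation j (Q, \<sigma>) (mutate j Q, cyc (as @ [j] @ bs))"

section \<open>Proper mutation always exists and yields a cyclically ordered quiver\<close>

lemma cyc_self: "xs \<in> cyc xs"
  unfolding cyc_def by (auto intro: exI[of _ 0])

lemma cyc_append: "ys @ xs \<in> cyc (xs @ ys)"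
  unfolding cyc_def by (auto intro: exI[of _ "length xs"] simp: rotate_append)

lemma cyc_trans: "ys \<in> cyc xs \<Longrightarrow> zs \<in> cyc ys \<Longrightarrow> zs \<in> cyc xs"
  unfolding cyc_def by (auto simp: rotate_rotate)

lemma cyc_same_hd:
  assumes "distinct xs" "j # ys \<in> cyc xs" "j # zs \<in> cyc xs"
  shows "ys = zs"
proof -
  from assms obtain m n where mn: "j # ys = rotate m xs" "j # zs = rotate n xs"
    by (auto simp: cyc_def)
  then have ne: "xs \<noteq> []" by auto
  have "xs ! (m mod length xs) = xs ! (n mod length xs)"
    using mn hd_rotate_conv_nth[OF ne] by (metis list.sel(1))
  then have "m mod length xs = n mod length xs"
    using assms(1) ne by (simp add: nth_eq_iff_index_eq)
  then show ?thesis
    using mn by (metis rotate_conv_mod list.inject)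
qed

lemma proper_mutation_is_coq:
  assumes "proper_mutation j C C'"
  shows "is_coq C'"
  using assms
proof cases
  case (1 Q \<sigma> as bs)
  from 1(3) obtain xs where xs: "distinct xs" "set xs = verts Q" "\<sigma> = cyc xs"
    by (auto simp: cyclic_ordering_def)
  with 1(5) obtain n where n: "j # as @ bs = rotate n xs"
    by (auto simp: cyc_def)
  have "distinct (j # as @ bs)" "set (j # as @ bs) = verts Q"
    unfolding n using xs by auto
  then have "cyclic_ordering (verts Q) (cyc (as @ [j] @ bs))"
    unfolding cyclic_ordering_def by (intro exI[of _ "as @ [j] @ bs"]) auto
  then show ?thesis
    using 1 is_quiver_mutate by auto
qed

lemma proper_mutation_exists:
  assumes "is_coq C" "proper j C"
  shows "\<exists>C'. proper_mutation j C C'"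
proof -
  obtain Q \<sigma> where C: "C = (Q, \<sigma>)" by (cases C)
  have Q: "is_quiver Q" and j: "j \<in> verts Q" using assms C by auto
  from assms C obtain xs where xs: "distinct xs" "set xs = verts Q" "\<sigma> = cyc xs"
    by (auto simp: cyclic_ordering_def)
  with j obtain p s where ps: "xs = p @ j # s" by (metis split_list)
  define ys where "ys = s @ p"
  have ys: "j # ys \<in> cyc xs"
    unfolding ys_def ps using cyc_append[of "j # s" p] by simp
  have set_ys: "verts Q = insert j (set ys)" "distinct (j # ys)"
    using xs ps ys_def by auto
  define as where "as = takeWhile (\<lambda>v. v \<notin> In Q j) ys"
  define bs where "bs = dropWhile (\<lambda>v. v \<notin> In Q j) ys"
  have ab: "ys = as @ bs" by (simp add: as_def bs_def)
  have disj: "In Q j \<inter> set as = {}"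
    by (auto simp: as_def dest: set_takeWhileD)
  have "Out Q j \<subseteq> set as"
  proof
    fix k assume k: "k \<in> Out Q j"
    show "k \<in> set as"
    proof (rule ccontr)
      assume nk: "k \<notin> set as"
      have "k \<in> verts Q" "k \<noteq> j"
        using k Q by (auto simp: Out_def is_quiver_def)
      then have kb: "k \<in> set bs" using nk set_ys ab by auto
      then obtain i bs' where bs': "bs = i # bs'" by (cases bs) auto
      have i: "i \<in> In Q j"
        using bs' unfolding bs_def by (metis dropWhile_eq_Cons_conv)
      have "i \<noteq> k" 
        using i k Q by (auto simp: In_def Out_def is_quiver_def) (metis less_irrefl)
      then have kb': "k \<in> set bs'" using kb bs' by auto
      then obtain b1 b2 where b: "bs' = b1 @ k # b2" by (metis split_list)
      from assms C i k have "right_turn \<sigma> i j k" by auto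
      then obtain a1 a2 a3 a4 where
        r: "(a1 @ [i] @ a2) @ (j # a3 @ k # a4) \<in> cyc xs"
        unfolding right_turn_def xs(3) by auto
      have "j # a3 @ k # a4 @ a1 @ i # a2 \<in> cyc xs"
        using cyc_trans[OF r cyc_append] by simp
      from cyc_same_hd[OF xs(1) this ys]
      have eq: "a3 @ k # a4 @ a1 @ i # a2 = as @ i # b1 @ k # b2"
        using ab bs' b by simp
      have d: "distinct (as @ i # b1 @ k # b2)"
        using set_ys(2) ab bs' b by simp
      have "i \<notin> set as" "i \<notin> set (b1 @ k # b2)"
        using d by auto
      moreover have "as @ i # (b1 @ k # b2) = (a3 @ k # a4 @ a1) @ i # a2"
        using eq by simp
      ultimately have "as = a3 @ k # a4 @ a1"
        using append_Cons_eq_iff[of i as "b1 @ k # b2" "a3 @ k # a4 @ a1" a2] by blast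
      then show False using nk by auto
    qed
  qed
  with disj have "proper_mutation j (Q, \<sigma>) (mutate j Q, cyc (as @ [j] @ bs))"
    using assms C ys ab xs by (intro proper_mutation.intros) auto
  then show ?thesis using C by blast
qed

end

theory Submission
  imports Defs
begin

text \<open>
  Unroll the circle: a cyclic ordering, cut open to a list, places its vertices on the real
  line, and a wiggle equivalence carries each vertex to a new place, possibly some full turns
  away. Since adjacent vertices never meet, the integer parts of the differences of their
  places are preserved; conversely these integer parts determine the wiggle class. Cut both
  cyclic orderings open at \<open>j\<close>. Then the neighbours of \<open>j\<close> make the same number of turns as \<open>j\<close>,
  and \<open>Out Q j\<close> precedes \<open>In Q j\<close> in both lists. Hence the integer parts also agree for the
  pairs that become adjacent by mutation, and they still agree after \<open>j\<close> has been moved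
  to the place between \<open>Out Q j\<close> and \<open>In Q j\<close>.
\<close>

section \<open>Order within a list, rotation, and adjacency\<close>

fun precedes :: "'v list \<Rightarrow> 'v \<Rightarrow> 'v \<Rightarrow> bool" where
  "precedes [] u v \<longleftrightarrow> False"
| "precedes (x # xs) u v \<longleftrightarrow> x = u \<and> v \<in> set xs \<or> precedes xs u v"

lemma precedes_in_set: "precedes xs u v \<Longrightarrow> u \<in> set xs \<and> v \<in> set xs"
  by (induction xs) auto

lemma precedes_append:
  "precedes (xs @ ys) u v \<longleftrightarrow>
     precedes xs u v \<or> precedes ys u v \<or> u \<in> set xs \<and> v \<in> set ys"
  by (induction xs) auto

lemma precedes_filter:
  "precedes (filter P xs) u v \<longleftrightarrow> P u \<and> P v \<and> precedes xs u v"
  by (induction xs) auto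

lemma cyc_append_commute: "cyc (xs @ ys) = cyc (ys @ xs)"
  using cyc_append cyc_trans by blast

text \<open>Replaces the rotation count by a cut into two blocks, the form in which turns are
  counted later.\<close>

lemma cyc_split:
  assumes "ys \<in> cyc xs"
  obtains as bs where "xs = as @ bs" "ys = bs @ as"
proof -
  from assms obtain n where "ys = rotate n xs" by (auto simp: cyc_def)
  then show thesis
    using that[of "take (n mod length xs) xs" "drop (n mod length xs) xs"]
    by (simp add: rotate_drop_take)
qed

lemma is_coq_mem:
  assumes "is_coq (Q, \<sigma>)" "xs \<in> \<sigma>"
  shows "\<sigma> = cyc xs" "distinct xs" "set xs = verts Q"
proof -
  obtain zs where zs: "distinct zs" "set zs = verts Q" "\<sigma> = cyc zs"
    using assms(1) by (auto simp: cyclic_ordering_def)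
  with assms(2) obtain as bs where "zs = as @ bs" "xs = bs @ as"
    by (auto elim: cyc_split)
  then show "\<sigma> = cyc xs" "distinct xs" "set xs = verts Q"
    using zs by (auto simp: cyc_append_commute)
qed

lemma cyclic_ordering_cyc [simp]: "cyclic_ordering V (cyc xs) \<longleftrightarrow> distinct xs \<and> set xs = V"
proof
  assume "cyclic_ordering V (cyc xs)"
  then obtain zs as bs where "distinct zs" "set zs = V" "zs = as @ bs" "xs = bs @ as"
    unfolding cyclic_ordering_def by (metis cyc_self cyc_split)
  then show "distinct xs \<and> set xs = V" by auto
qed (auto simp: cyclic_ordering_def)

lemma is_coq_cyc:
  "is_coq (Q, cyc xs) \<longleftrightarrow> is_quiver Q \<and> distinct xs \<and> set xs = verts Q"
  by simp

lemma is_coq_nonempty: "is_coq (Q, \<sigma>) \<Longrightarrow> \<exists>xs. xs \<in> \<sigma>"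
  by (auto simp: cyclic_ordering_def intro: cyc_self)

lemma adjacent_sym: "adjacent Q u v \<longleftrightarrow> adjacent Q v u"
  by (auto simp: adjacent_def)

lemma adjacent_verts: "is_quiver Q \<Longrightarrow> adjacent Q u v \<Longrightarrow> u \<in> verts Q \<and> v \<in> verts Q"
  by (auto simp: adjacent_def is_quiver_def)

lemma adjacent_irrefl: "is_quiver Q \<Longrightarrow> \<not> adjacent Q u u"
  by (auto simp: adjacent_def is_quiver_def)

section \<open>The integer parts as an invariant of wiggles\<close>

text \<open>
  Place the \<open>m\<close>-th entry of \<open>xs\<close> at \<open>m / length xs\<close>, and the \<open>m\<close>-th entry \<open>v\<close> of \<open>ys\<close> at
  \<open>d v + m / length ys\<close>. The condition says that for adjacent vertices the
  difference of their places has the same integer part in both placements.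
\<close>

definition same_region :: "'v quiver \<Rightarrow> 'v list \<Rightarrow> 'v list \<Rightarrow> ('v \<Rightarrow> int) \<Rightarrow> bool" where
  "same_region Q xs ys d \<longleftrightarrow>
     (\<forall>u v. adjacent Q u v \<longrightarrow>
        d u - of_bool (precedes ys u v) = d v - of_bool (precedes xs u v))"

lemma same_region_sym: "same_region Q xs ys d \<Longrightarrow> same_region Q ys xs (\<lambda>v. - d v)"
  unfolding same_region_def by (smt (verit))

lemma same_region_trans:
  "same_region Q xs ys d \<Longrightarrow> same_region Q ys zs e \<Longrightarrow>
   same_region Q xs zs (\<lambda>v. d v + e v)"
  unfolding same_region_def by (smt (verit))

lemma same_region_shift:
  "same_region Q xs ys (\<lambda>v. d v + c) \<longleftrightarrow> same_region Q xs ys d"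
  unfolding same_region_def by (smt (verit))

text \<open>With this \<open>d\<close> every place moves by the same fraction of a turn,
  \<open>length bs / length (as @ bs)\<close>; the entries of \<open>bs\<close> cross the cut and
  count one turn. A common translation alters no difference.\<close>

lemma same_region_rotate:
  assumes "is_coq (Q, cyc (as @ bs))"
  shows "same_region Q (as @ bs) (bs @ as) (\<lambda>v. of_bool (v \<in> set bs))"
proof -
  have *: "is_quiver Q" "set as \<inter> set bs = {}" "set as \<union> set bs = verts Q"
    using assms by (auto simp: is_coq_cyc)
  show ?thesis
    unfolding same_region_def precedes_append
  proof (intro allI impI)
    fix u v assume "adjacent Q u v"
    then have "u \<in> set as \<union> set bs" "v \<in> set as \<union> set bs"
      using adjacent_verts[OF *(1)] unfolding *(3) by simp_all
    moreover have "w \<notin> set as \<or> w \<notin> set bs" for w using *(2) by blast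
    ultimately show "of_bool (u \<in> set bs) -
        of_bool (precedes bs u v \<or> precedes as u v \<or> u \<in> set bs \<and> v \<in> set as) =
        (of_bool (v \<in> set bs) :: int) -
        of_bool (precedes as u v \<or> precedes bs u v \<or> u \<in> set as \<and> v \<in> set bs)"
      using precedes_in_set[of as u v] precedes_in_set[of bs u v]
      by (auto simp: of_bool_def)
  qed
qed

lemma same_region_cyc:
  assumes "is_coq (Q, cyc xs)" "ys \<in> cyc xs"
  shows "\<exists>d. same_region Q xs ys d"
  using assms by (metis cyc_split same_region_rotate)

text \<open>Only \<open>u\<close> and \<open>v\<close> change their order, and they are not
  adjacent, so zero displacement relates the two displayed lists. Other representatives are reached
  by rotation.\<close>

lemma wiggle_same_region:
  assumes "wiggle C C'"
  shows "fst C' = fst C \<and> is_coq C \<and> is_coq C' \<and>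
    (\<forall>xs\<in>snd C. \<forall>ys\<in>snd C'. \<exists>d. same_region (fst C) xs ys d)"
  using assms
proof cases
  case (1 Q u v ws)
  have coq: "is_coq (Q, cyc (u # v # ws))" "is_coq (Q, cyc (v # u # ws))"
    using 1(3) by (auto simp: is_coq_cyc)
  have mid: "same_region Q (u # v # ws) (v # u # ws) (\<lambda>_. 0)"
    using 1(4) coq by (auto simp: same_region_def adjacent_sym is_coq_cyc)
  have "\<exists>d. same_region Q xs ys d"
    if "xs \<in> cyc (u # v # ws)" "ys \<in> cyc (v # u # ws)" for xs ys
    using same_region_cyc[OF coq(1) that(1)] same_region_cyc[OF coq(2) that(2)] mid
    by (metis same_region_sym same_region_trans)
  then show ?thesis using 1(1,2) coq by simp
qed

text \<open>Displacements add up along a chain of wiggles. Covering all representatives leaves the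
  choice of the cut open, so that both orderings can be cut at \<open>j\<close>.\<close>

lemma wiggle_equivalent_same_region:
  assumes "wiggle_equivalent (Q, \<sigma>) C" "is_coq (Q, \<sigma>)"
  shows "fst C = Q \<and> is_coq C \<and> (\<forall>xs\<in>\<sigma>. \<forall>ys\<in>snd C. \<exists>d. same_region Q xs ys d)"
  using assms(1)
proof (induction rule: equivclp_induct)
  case base
  have "\<exists>d. same_region Q xs ys d" if "xs \<in> \<sigma>" "ys \<in> \<sigma>" for xs ys
    using same_region_cyc is_coq_mem(1)[OF assms(2) that(1)] assms(2) that(2) by metis
  then show ?case using assms(2) by auto
next
  case (step C C')
  have S: "fst C' = fst C" "is_coq C'"
    "\<forall>xs\<in>snd C. \<forall>ys\<in>snd C'. \<exists>d. same_region (fst C) xs ys d"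
    using step(2)
  proof (atomize (full), elim disjE)
    assume "wiggle C' C"
    then show "fst C' = fst C \<and> is_coq C' \<and>
        (\<forall>xs\<in>snd C. \<forall>ys\<in>snd C'. \<exists>d. same_region (fst C) xs ys d)"
      using wiggle_same_region[of C' C] by (metis same_region_sym)
  qed (use wiggle_same_region[of C C'] in blast)
  obtain zs where zs: "zs \<in> snd C"
    using step(3) is_coq_nonempty by (metis prod.collapse)
  have "\<exists>d. same_region Q xs ys d" if "xs \<in> \<sigma>" "ys \<in> snd C'" for xs ys
    using S(3) step(3) zs that same_region_trans by metis
  then show ?case using S step(3) by auto
qed

section \<open>Recovering wiggle equivalence from the invariant\<close>

lemma wiggle_equivalent_swap:
  assumes "is_coq (Q, cyc (as @ u # v # bs))" "\<not> adjacent Q u v"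
  shows "wiggle_equivalent (Q, cyc (as @ u # v # bs)) (Q, cyc (as @ v # u # bs))"
proof -
  have eq: "cyc (as @ x # y # bs) = cyc (x # y # bs @ as)" for x y
    using cyc_append_commute[of as "x # y # bs"] by simp
  show ?thesis
    using assms unfolding eq by (intro r_into_equivclp wiggle.intros)
qed

lemma wiggle_equivalent_move:
  assumes "is_coq (Q, cyc (p @ as @ u # bs))" "\<forall>a\<in>set as. \<not> adjacent Q a u"
  shows "wiggle_equivalent (Q, cyc (p @ as @ u # bs)) (Q, cyc (p @ u # as @ bs))"
  using assms
proof (induction as arbitrary: bs rule: rev_induct)
  case Nil
  then show ?case by simp
next
  case (snoc a as)
  have "wiggle_equivalent (Q, cyc ((p @ as) @ a # u # bs)) (Q, cyc ((p @ as) @ u # a # bs))"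
    using snoc.prems by (intro wiggle_equivalent_swap) auto
  moreover have "wiggle_equivalent (Q, cyc (p @ as @ u # a # bs)) (Q, cyc (p @ u # as @ a # bs))"
    using snoc.prems by (intro snoc.IH) (auto simp: is_coq_cyc)
  ultimately show ?case by (simp add: equivclp_trans)
qed

text \<open>Selection sort by wiggles: the head of \<open>ys\<close> is brought to the front of
  \<open>xs\<close> and then joins \<open>p\<close>, which collects the entries already in
  place.\<close>

lemma wiggle_equivalent_if_precedes_eq:
  assumes "is_coq (Q, cyc (p @ xs))" "distinct ys" "set ys = set xs"
    and "\<And>u v. adjacent Q u v \<Longrightarrow> u \<in> set xs \<Longrightarrow> v \<in> set xs \<Longrightarrow>
           precedes xs u v \<longleftrightarrow> precedes ys u v"
  shows "wiggle_equivalent (Q, cyc (p @ xs)) (Q, cyc (p @ ys))"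
  using assms
proof (induction ys arbitrary: p xs)
  case Nil
  then show ?case by simp
next
  case (Cons y ys)
  obtain as bs where xs: "xs = as @ y # bs"
    using Cons.prems(3) by (metis list.set_intros(1) split_list)
  have d: "distinct (as @ y # bs)"
    using Cons.prems(1) xs by (auto simp: is_coq_cyc)
  \<comment> \<open>Nothing precedes the head \<open>y\<close> in \<open>y # ys\<close>, but an
    adjacent \<open>a\<close> before \<open>y\<close> in \<open>xs\<close> would have to.\<close>
  have "\<not> adjacent Q a y" if "a \<in> set as" for a
  proof
    assume "adjacent Q a y"
    moreover have "precedes xs a y" using that by (simp add: xs precedes_append)
    ultimately have "precedes (y # ys) a y" using Cons.prems(4) that xs by auto
    then show False
      using Cons.prems(2) precedes_in_set[of ys a y] by auto
  qed
  then have "wiggle_equivalent (Q, cyc (p @ xs)) (Q, cyc (p @ y # as @ bs))"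
    using Cons.prems(1) unfolding xs by (intro wiggle_equivalent_move) auto
  moreover have "wiggle_equivalent (Q, cyc ((p @ [y]) @ as @ bs)) (Q, cyc ((p @ [y]) @ ys))"
  proof (rule Cons.IH)
    show "is_coq (Q, cyc ((p @ [y]) @ as @ bs))"
      using Cons.prems(1) xs by (auto simp: is_coq_cyc)
    show "set ys = set (as @ bs)"
      using Cons.prems(2,3) d xs by auto
    fix u v assume *: "adjacent Q u v" "u \<in> set (as @ bs)" "v \<in> set (as @ bs)"
    then have "u \<noteq> y" "v \<noteq> y" using d by auto
    then have "precedes (as @ bs) u v \<longleftrightarrow> precedes xs u v"
      and "precedes ys u v \<longleftrightarrow> precedes (y # ys) u v"
      by (auto simp: xs precedes_append)
    then show "precedes (as @ bs) u v \<longleftrightarrow> precedes ys u v"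
      using Cons.prems(4)[of u v] * xs by auto
  qed (use Cons.prems(2) in auto)
  ultimately show ?case by (simp add: equivclp_trans)
qed

text \<open>
  A vertex with \<open>d v > 0\<close> cannot precede an adjacent vertex with \<open>d u = 0\<close>, so all vertices
  with \<open>d v > 0\<close> can be wiggled to the end of the list and from there rotated to the front,
  which completes one of their \<open>d v\<close> turns.
\<close>

lemma same_region_bounded_imp_wiggle_equivalent:
  assumes "is_coq (Q, cyc xs)" "is_coq (Q, cyc ys)" "same_region Q xs ys d"
    and "\<And>v. v \<in> verts Q \<Longrightarrow> 0 \<le> d v \<and> d v \<le> int N"
  shows "wiggle_equivalent (Q, cyc xs) (Q, cyc ys)"
  using assms
proof (induction N arbitrary: xs d)
  case 0
  \<comment> \<open>Here \<open>d\<close> vanishes on the vertices, so the condition just compares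
    the two orders.\<close>
  have "precedes xs u v \<longleftrightarrow> precedes ys u v" if "adjacent Q u v" for u v
  proof -
    have "u \<in> verts Q" "v \<in> verts Q"
      using that 0(1) adjacent_verts[of Q u v] by auto
    then have "d u = 0" "d v = 0" using 0(4) by force+
    then show ?thesis using 0(3) that by (force simp: same_region_def)
  qed
  then show ?case
    using wiggle_equivalent_if_precedes_eq[of Q "[]" xs ys] 0(1,2) by (auto simp: is_coq_cyc)
next
  case (Suc N)
  define D where "D = (\<lambda>v. d v > 0)"
  define as where "as = filter (\<lambda>v. \<not> D v) xs"
  define bs where "bs = filter D xs"
  have ab: "is_coq (Q, cyc (as @ bs))"
    using Suc.prems(1) by (auto simp: is_coq_cyc as_def bs_def)
  have V: "set xs = verts Q" "is_quiver Q" using Suc.prems(1) by (auto simp: is_coq_cyc)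
  \<comment> \<open>Filtering keeps the order within each block, so only adjacent pairs from
    different blocks need the condition.\<close>
  have prec: "precedes xs u v \<longleftrightarrow> precedes (as @ bs) u v" if "adjacent Q u v" for u v
  proof -
    have uv: "u \<in> verts Q" "v \<in> verts Q" using adjacent_verts[OF V(2) that] by auto
    have "d u - of_bool (precedes ys u v) = d v - of_bool (precedes xs u v)"
      using Suc.prems(3) that by (simp add: same_region_def)
    moreover have "0 \<le> d u" "0 \<le> d v" using Suc.prems(4) uv by auto
    ultimately have "\<not> D u \<Longrightarrow> D v \<Longrightarrow> precedes xs u v" "D u \<Longrightarrow> \<not> D v \<Longrightarrow> \<not> precedes xs u v"
      by (auto simp: D_def of_bool_def split: if_splits)
    then show ?thesis
      using uv V by (auto simp: precedes_append precedes_filter as_def bs_def)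
  qed
  have "wiggle_equivalent (Q, cyc xs) (Q, cyc (as @ bs))"
    using wiggle_equivalent_if_precedes_eq[of Q "[]" xs "as @ bs"] Suc.prems(1) ab prec
    by (auto simp: is_coq_cyc)
  moreover have "wiggle_equivalent (Q, cyc (bs @ as)) (Q, cyc ys)"
  proof (rule Suc.IH)
    show "is_coq (Q, cyc (bs @ as))" using ab by auto
    \<comment> \<open>Undoing the rotation subtracts 1 exactly where \<open>d\<close> is positive,
      so the bound drops to \<open>N\<close>.\<close>
    have "same_region Q (as @ bs) ys d"
      using Suc.prems(3) prec by (simp add: same_region_def)
    then show "same_region Q (bs @ as) ys (\<lambda>v. - of_bool (v \<in> set bs) + d v)"
      using same_region_sym[OF same_region_rotate[OF ab]] same_region_trans by blast
    fix v assume "v \<in> verts Q"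
    then show "0 \<le> - of_bool (v \<in> set bs) + d v \<and> - of_bool (v \<in> set bs) + d v \<le> int N"
      using Suc.prems(4)[of v] V by (auto simp: bs_def D_def)
  qed (rule Suc.prems(2))
  ultimately show ?case by (metis cyc_append_commute equivclp_trans)
qed

text \<open>Only differences of \<open>d\<close> matter; adding a bound \<open>M\<close> for its
  absolute values puts it between 0 and \<open>2 * M\<close>.\<close>

lemma same_region_imp_wiggle_equivalent:
  assumes "is_coq (Q, cyc xs)" "is_coq (Q, cyc ys)" "same_region Q xs ys d"
  shows "wiggle_equivalent (Q, cyc xs) (Q, cyc ys)"
proof -
  define M where "M = (\<Sum>v\<in>verts Q. \<bar>d v\<bar>)"
  have "finite (verts Q)" using assms(1) by (simp add: is_quiver_def)
  then have M: "\<bar>d v\<bar> \<le> M" if "v \<in> verts Q" for v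
    unfolding M_def using that by (intro member_le_sum) auto
  have "same_region Q xs ys (\<lambda>v. d v + M)"
    using assms(3) by (simp add: same_region_shift)
  moreover have "0 \<le> d v + M \<and> d v + M \<le> int (nat (2 * M))" if "v \<in> verts Q" for v
    using M[OF that] by linarith
  ultimately show ?thesis
    using assms(1,2) same_region_bounded_imp_wiggle_equivalent by blast
qed

section \<open>The invariant under mutation at \<open>j\<close>\<close>

text \<open>A shortcut starting or ending at \<open>j\<close> would need a loop, so arrows at
  \<open>j\<close> are merely reversed.\<close>

lemma adjacent_mutate_at:
  assumes "is_quiver Q" "adjacent (mutate j Q) u v" "u = j \<or> v = j"
  shows "adjacent Q u v"
  using assms
  by (auto simp: adjacent_def mutate_def cancel_2cycles_def reverse_at_def
      add_shortcuts_def is_quiver_def)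

lemma adjacent_mutate_cases:
  assumes "adjacent (mutate j Q) u v" "u \<noteq> j" "v \<noteq> j"
  obtains "adjacent Q u v" | "u \<in> In Q j" "v \<in> Out Q j" | "v \<in> In Q j" "u \<in> Out Q j"
  using assms
  by (auto simp: adjacent_def mutate_def cancel_2cycles_def reverse_at_def
      add_shortcuts_def In_def Out_def split: if_splits)
     (metis add_gr_0 diff_is_0_eq gr0I mult_is_0 zero_le)+

text \<open>The same \<open>d\<close> still works. Three kinds of pairs are checked: those
  containing \<open>j\<close>, those joined by a path through \<open>j\<close>, and those adjacent
  before.\<close>

lemma same_region_mutate:
  assumes coq: "is_coq (Q, cyc (j # as @ bs))" "is_coq (Q, cyc (j # as' @ bs'))"
    and out: "Out Q j \<subseteq> set as" "Out Q j \<subseteq> set as'"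
    and inn: "In Q j \<inter> set as = {}" "In Q j \<inter> set as' = {}"
    and R: "same_region Q (j # as @ bs) (j # as' @ bs') d"
  shows "same_region (mutate j Q) (as @ [j] @ bs) (as' @ [j] @ bs') d"
proof -
  have Q: "is_quiver Q" and ds: "distinct (j # as @ bs)" "distinct (j # as' @ bs')"
    and st: "set (j # as @ bs) = verts Q" "set (j # as' @ bs') = verts Q"
    using coq by (simp_all only: is_coq_cyc)
  have nbr: "adjacent Q j w \<longleftrightarrow> w \<in> In Q j \<or> w \<in> Out Q j" for w
    by (auto simp: adjacent_def In_def Out_def)
  have dn: "d w = d j" and w: "w \<noteq> j" "w \<in> set as \<union> set bs" "w \<in> set as' \<union> set bs'"
    if "adjacent Q j w" for w
  proof -
    show "w \<noteq> j" using that Q adjacent_irrefl by metis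
    moreover have "w \<in> verts Q" using that Q adjacent_verts by metis
    ultimately show wx: "w \<in> set as \<union> set bs" "w \<in> set as' \<union> set bs'" using st by auto
    \<comment> \<open>Since \<open>j\<close> heads both lists, both indicators are 1 and
      cancel.\<close>
    have "precedes (j # as @ bs) j w" "precedes (j # as' @ bs') j w" using wx by auto
    moreover have "d j - of_bool (precedes (j # as' @ bs') j w) =
        d w - of_bool (precedes (j # as @ bs) j w)"
      using R that unfolding same_region_def by blast
    ultimately show "d w = d j" by simp
  qed
  have disj: "In Q j \<inter> Out Q j = {}" using out inn by auto
  \<comment> \<open>A neighbour of \<open>j\<close> outside \<open>Out Q j\<close> is in
    \<open>In Q j\<close>, hence not in \<open>as\<close> and so in \<open>bs\<close>; likewise for
    the primed lists.\<close>
  have side: "w \<in> set as \<longleftrightarrow> w \<in> Out Q j" "w \<in> set as' \<longleftrightarrow> w \<in> Out Q j"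
    "w \<in> set bs \<longleftrightarrow> w \<in> In Q j" "w \<in> set bs' \<longleftrightarrow> w \<in> In Q j" if "adjacent Q j w" for w
    using w[OF that] nbr that out inn disj ds by auto
  have io: "precedes (as @ [j] @ bs) k i" "\<not> precedes (as @ [j] @ bs) i k"
    "precedes (as' @ [j] @ bs') k i" "\<not> precedes (as' @ [j] @ bs') i k" "d k = d i"
    if "i \<in> In Q j" "k \<in> Out Q j" for i k
  proof -
    have adj: "adjacent Q j i" "adjacent Q j k" using that nbr by auto
    then have "i \<noteq> j" "k \<noteq> j" using w by auto
    with side[OF adj(1)] side[OF adj(2)] that disj
    show "precedes (as @ [j] @ bs) k i" "\<not> precedes (as @ [j] @ bs) i k"
      "precedes (as' @ [j] @ bs') k i" "\<not> precedes (as' @ [j] @ bs') i k"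
      by (auto simp: precedes_append dest: precedes_in_set)
    show "d k = d i" using dn adj by simp
  qed
  have atj: "precedes (as @ [j] @ bs) j w = precedes (as' @ [j] @ bs') j w"
    "precedes (as @ [j] @ bs) w j = precedes (as' @ [j] @ bs') w j" "d w = d j"
    if "adjacent Q j w" for w
    using w[OF that] side[OF that] dn[OF that] ds
    by (auto simp: precedes_append dest: precedes_in_set)
  show ?thesis
    unfolding same_region_def
  proof (intro allI impI)
    fix u v assume adj: "adjacent (mutate j Q) u v"
    show "d u - of_bool (precedes (as' @ [j] @ bs') u v) =
        d v - of_bool (precedes (as @ [j] @ bs) u v)"
    proof (cases "u = j \<or> v = j")
      case True
      then have "adjacent Q u v" using adjacent_mutate_at[OF Q adj] by simp
      then show ?thesis using True atj[of u] atj[of v] adjacent_sym[of Q u v] by auto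
    next
      case False
      then have "u \<noteq> j" "v \<noteq> j" by auto
      with adj show ?thesis
      proof (cases rule: adjacent_mutate_cases)
        case 1
        then have "d u - of_bool (precedes (j # as' @ bs') u v) =
            d v - of_bool (precedes (j # as @ bs) u v)"
          using R by (simp add: same_region_def)
        \<comment> \<open>Moving \<open>j\<close> leaves the order of any two other entries
          unchanged.\<close>
        moreover have "precedes (xs @ [j] @ ys) u v \<longleftrightarrow> precedes (j # xs @ ys) u v" for xs ys
          using False by (auto simp: precedes_append)
        ultimately show ?thesis by simp
      qed (use io in auto)
    qed
  qed
qed

theorem proposition6p4:
  fixes Q :: "'v quiver" and \<sigma> \<sigma>' :: "'v list set" and j :: 'v and C C' :: "'v coq"
  assumes "is_coq (Q, \<sigma>)" and "is_coq (Q, \<sigma>')"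
    and "wiggle_equivalent (Q, \<sigma>) (Q, \<sigma>')"
    and "proper j (Q, \<sigma>)" and "proper j (Q, \<sigma>')"
    and "proper_mutation j (Q, \<sigma>) C" and "proper_mutation j (Q, \<sigma>') C'"
  shows "wiggle_equivalent C C'"
proof -
  obtain as bs where C: "C = (mutate j Q, cyc (as @ [j] @ bs))" "j # as @ bs \<in> \<sigma>"
    "Out Q j \<subseteq> set as" "In Q j \<inter> set as = {}"
    using assms(6) by (auto elim: proper_mutation.cases)
  obtain as' bs' where C': "C' = (mutate j Q, cyc (as' @ [j] @ bs'))" "j # as' @ bs' \<in> \<sigma>'"
    "Out Q j \<subseteq> set as'" "In Q j \<inter> set as' = {}"
    using assms(7) by (auto elim: proper_mutation.cases)
  obtain d where "same_region Q (j # as @ bs) (j # as' @ bs') d"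
    using wiggle_equivalent_same_region[OF assms(3,1)] C(2) C'(2) by auto
  moreover have "is_coq (Q, cyc (j # as @ bs))" "is_coq (Q, cyc (j # as' @ bs'))"
    using assms(1,2) is_coq_mem(1) C(2) C'(2) by metis+
  ultimately have "same_region (mutate j Q) (as @ [j] @ bs) (as' @ [j] @ bs') d"
    using C C' by (intro same_region_mutate)
  then show ?thesis
    using proper_mutation_is_coq[OF assms(6)] proper_mutation_is_coq[OF assms(7)]
    unfolding C(1) C'(1) by (intro same_region_imp_wiggle_equivalent)
qed

end
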